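(* Let $X\sim\Gamma(1,1)$ and let $p,q$ be real numbers. For every integer $n\ge 0$, $$E\bigg[\frac{(X-1+p+iq)^{n}+(X-1+p-iq)^{n}}{2}\bigg]=D_{n}^{(c)}(p,q).$$
   Context: Here $i=\sqrt{-1}$. $X\sim\Gamma(1,1)$ means that $X$ is a gamma random variable with parameters $\alpha=1,\lambda=1$, i.e. a real random variable with density $f(x)=e^{-x}$ for $x\ge 0$ and $f(x)=0$ for $x<0$; $E$ denotes expectation. The cosine-derangement polynomials $D_n^{(c)}(x,y)$, $n\ge 0$, are defined by the generating function (power series in $t$) $\displaystyle\frac{e^{-t}}{1-t}e^{xt}\cos(yt)=\sum_{n=0}^{\infty}D_{n}^{(c)}(x,y)\frac{t^{n}}{n!}$. *)

theory Defs
  imports "HOL-Probability.Probability" "HOL-Computational_Algebra.Formal_Power_Series"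
begin

text \<open>The generating function in \<open>t\<close> is taken as a formal power series (\<open>t\<close> is \<^const>\<open>fps_X\<close>);
  \<^term>\<open>fps_exp x\<close> is \<open>e\<^sup>x\<^sup>t\<close> and \<^term>\<open>fps_cos y\<close> is \<open>cos (y t)\<close>.\<close>

definition cos_derangement_gf :: "real \<Rightarrow> real \<Rightarrow> real fps" where
  "cos_derangement_gf x y = fps_exp (-1) / (1 - fps_X) * fps_exp x * fps_cos y"

definition cos_derangement :: "nat \<Rightarrow> real \<Rightarrow> real \<Rightarrow> real" where
  "cos_derangement n x y = fact n * fps_nth (cos_derangement_gf x y) n"

lemma cos_derangement_gf_eq:
  "cos_derangement_gf x y = Abs_fps (\<lambda>n. cos_derangement n x y / fact n)"
  by (simp add: fps_eq_iff cos_derangement_def)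

end

theory Submission imports Defs begin

text \<open>Put \<open>z = p - 1 + \<i>q\<close>. Since \<open>p\<close>, \<open>q\<close> and \<open>X\<close> are real, the two powers in the integrand are
  complex conjugates, so their half sum is \<open>Re ((X + z)\<^sup>n)\<close>. Both sides of the identity are the real
  part of \<open>n! (\<Sum>k\<le>n. z\<^sup>k / k!)\<close>, a truncated exponential series.

  On the analytic side, a random variable with density \<open>exp (-x)\<close> on \<open>x \<ge> 0\<close> has moments
  \<open>E X\<^sup>k = k!\<close>, and the binomial theorem turns this into \<open>E (X + z)\<^sup>n = n! (\<Sum>k\<le>n. z\<^sup>k / k!)\<close>, because
  \<open>(n choose k) (n - k)! = n! / k!\<close> (\<open>has_bochner_integral_exponential_shift_power\<close>).
  On the generating function side, \<open>exp (-t) exp (pt) cos (qt)\<close> is the coefficientwise real part of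
  \<open>exp (zt)\<close> (\<open>fps_nth_exp_mult_cos\<close>), and dividing by \<open>1 - t\<close> sums the coefficients
  (\<open>cos_derangement_eq_Re_sum\<close>).\<close>

text \<open>Expanding in powers of \<open>X\<close> reduces the claim to the moments \<open>E X\<^sup>m = m!\<close>; with \<open>z\<close> kept as an
  arbitrary complex shift, the binomial coefficients cancel against these factorials.\<close>

lemma has_bochner_integral_exponential_shift_power:
  fixes X :: "'a \<Rightarrow> real" and z :: complex
  assumes "prob_space M" and D: "distributed M lborel X (exponential_density 1)"
  shows "has_bochner_integral M (\<lambda>\<omega>. (complex_of_real (X \<omega>) + z) ^ n)
    (fact n * (\<Sum>k\<le>n. z ^ k / fact k))"
proof -
  interpret prob_space M by fact
  have moment: "has_bochner_integral M (\<lambda>\<omega>. complex_of_real (X \<omega>) ^ m) (fact m)" for m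
    using has_bochner_integral_of_real[OF has_bochner_integral_erlang_ith_moment[OF zero_less_one D, of m],
        where ?'a = complex]
    by simp
  have "has_bochner_integral M
      (\<lambda>\<omega>. \<Sum>k\<le>n. of_nat (n choose k) * z ^ k * complex_of_real (X \<omega>) ^ (n - k))
      (\<Sum>k\<le>n. of_nat (n choose k) * z ^ k * fact (n - k))"
    by (intro has_bochner_integral_sum has_bochner_integral_mult_right moment)
  also have "(\<lambda>\<omega>. \<Sum>k\<le>n. of_nat (n choose k) * z ^ k * complex_of_real (X \<omega>) ^ (n - k)) =
      (\<lambda>\<omega>. (complex_of_real (X \<omega>) + z) ^ n)"
    by (simp add: binomial_ring[of z, simplified add.commute[of z]])
  also have "(\<Sum>k\<le>n. of_nat (n choose k) * z ^ k * fact (n - k)) =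
      fact n * (\<Sum>k\<le>n. z ^ k / fact k)"
    by (simp add: sum_distrib_left binomial_fact)
  finally show ?thesis .
qed

lemma fps_nth_cos_eq_Re:
  "fps_nth (fps_cos q) k = Re ((\<i> * complex_of_real q) ^ k) / fact k" for q :: real
proof (cases "even k")
  case True
  then obtain m where "k = 2 * m" by blast
  moreover have "(\<i> * complex_of_real q) ^ (2 * m) = of_real ((- 1) ^ m * q ^ (2 * m))"
    by (simp only: power_mult_distrib power_mult power2_i of_real_mult of_real_power
        of_real_minus of_real_1)
  ultimately show ?thesis
    by (simp only: Re_complex_of_real) (simp add: fps_cos_def)
next
  case False
  then obtain m where "k = 2 * m + 1" by (blast elim: oddE)
  then show ?thesis
    by (simp add: fps_cos_def power_mult_distrib power_mult power_add flip: of_real_power)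
qed

lemma Re_divide_fact: "Re (w / fact k) = Re w / fact k"
  using Re_divide_of_real[of w "fact k"] by simp

lemma Re_fact_mult: "Re (fact k * w) = fact k * Re w"
  using scaleR_complex.sel(1)[of "fact k" w]
  by (simp add: scaleR_conv_of_real del: scaleR_complex.sel times_complex.sel)

text \<open>The formal counterpart of \<open>exp (at) cos (qt) = Re (exp ((a + \<i>q) t))\<close> for real \<open>t\<close>. The real
  part is taken coefficientwise in \<open>exp (at) exp (\<i>qt)\<close>; it passes to the second factor because
  \<open>exp (at)\<close> has real coefficients.\<close>

lemma fps_nth_exp_mult_cos:
  fixes a q :: real
  shows "fps_nth (fps_exp a * fps_cos q) n = Re (Complex a q ^ n) / fact n"
proof -
  have "Complex a q ^ n / fact n =
      fps_nth (fps_exp (complex_of_real a) * fps_exp (\<i> * complex_of_real q)) n"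
    by (simp add: Complex_eq flip: fps_exp_add_mult)
  also have "\<dots> = (\<Sum>i=0..n. of_real (a ^ i / fact i) *
      ((\<i> * complex_of_real q) ^ (n - i) / fact (n - i)))"
    by (simp add: fps_mult_nth)
  finally have "Re (Complex a q ^ n / fact n) =
      (\<Sum>i=0..n. a ^ i / fact i * Re ((\<i> * complex_of_real q) ^ (n - i) / fact (n - i)))"
    by (simp only: Re_sum Re_complex_of_real times_complex.simps Im_complex_of_real) simp
  then show ?thesis
    by (simp add: fps_mult_nth fps_nth_cos_eq_Re Re_divide_fact)
qed

text \<open>Dividing a power series by \<open>1 - t\<close> replaces its coefficients by their partial sums. The factor
  \<open>fact n\<close> stays inside the real part so that the argument is the value of the integral above.\<close>

lemma cos_derangement_eq_Re_sum:
  "cos_derangement n p q = Re (fact n * (\<Sum>k\<le>n. Complex (p - 1) q ^ k / fact k))"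
proof -
  have "fps_exp (p - 1) = fps_exp (-1) * fps_exp p"
    using fps_exp_add_mult[of "-1" p] by simp
  then have "cos_derangement_gf p q = (fps_exp (p - 1) * fps_cos q) / (1 - fps_X)"
    by (simp add: cos_derangement_gf_def fps_divide_unit mult_ac)
  then show ?thesis
    by (simp add: cos_derangement_def fps_divide_fps_X_minus1_sum fps_nth_exp_mult_cos
        atMost_atLeast0 Re_divide_fact Re_fact_mult)
qed

theorem theorem19:
  fixes M :: "'a measure" and X :: "'a \<Rightarrow> real" and p q :: real and n :: nat
  assumes "prob_space M"
    and "distributed M lborel X (\<lambda>x. ennreal (if 0 \<le> x then exp (- x) else 0))"
  shows "integrable M (\<lambda>\<omega>. ((complex_of_real (X \<omega>) - 1 + complex_of_real p + \<i> * complex_of_real q) ^ n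
            + (complex_of_real (X \<omega>) - 1 + complex_of_real p - \<i> * complex_of_real q) ^ n) / 2)
    \<and> prob_space.expectation M (\<lambda>\<omega>. ((complex_of_real (X \<omega>) - 1 + complex_of_real p + \<i> * complex_of_real q) ^ n
            + (complex_of_real (X \<omega>) - 1 + complex_of_real p - \<i> * complex_of_real q) ^ n) / 2)
        = complex_of_real (cos_derangement n p q)"
proof -
  let ?z = "Complex (p - 1) q"
  have "(\<lambda>x::real. ennreal (if 0 \<le> x then exp (- x) else 0)) = exponential_density 1"
    by (auto simp: exponential_density_def fun_eq_iff)
  with assms(2) have D: "distributed M lborel X (exponential_density 1)" by simp
  have half_sum: "((complex_of_real x - 1 + complex_of_real p + \<i> * complex_of_real q) ^ n
      + (complex_of_real x - 1 + complex_of_real p - \<i> * complex_of_real q) ^ n) / 2 =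
      of_real (Re ((complex_of_real x + ?z) ^ n))" for x
  proof -
    have plus: "complex_of_real x - 1 + complex_of_real p + \<i> * complex_of_real q =
        complex_of_real x + ?z"
      by (simp add: complex_eq_iff)
    have minus: "complex_of_real x - 1 + complex_of_real p - \<i> * complex_of_real q =
        cnj (complex_of_real x + ?z)"
      by (simp add: complex_eq_iff)
    show ?thesis
      unfolding plus minus by (simp only: complex_add_cnj flip: complex_cnj_power) simp
  qed
  have "has_bochner_integral M (\<lambda>\<omega>. complex_of_real (Re ((complex_of_real (X \<omega>) + ?z) ^ n)))
      (cos_derangement n p q)"
    unfolding cos_derangement_eq_Re_sum
    by (intro has_bochner_integral_of_real has_bochner_integral_Re
        has_bochner_integral_exponential_shift_power assms(1) D)
  then show ?thesis
    unfolding half_sum by (simp add: has_bochner_integral_iff)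
qed

end
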